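(* Let $X_n$, $n\in\mathbb N$, be a sequence of non-empty sets, let $\psi_n:X_n^2\to\mathbb R^+$, and put $X=\bigcup_{n\in\mathbb N}X_n$. Assume: (m1) there is a unique function $\psi:X^2\to\mathbb R^+$ such that $\psi_n=\psi\upharpoonright X_n^2$ for every $n$ and $\psi(u,v)=1$ whenever no $X_n$ contains both $u$ and $v$; (m2) for any $u,v,r\in X$, if $u,v,r\in X_n$, then there exists $m>n$ such that $u,v,r\in X_m$. Then $E((X_n,\psi_n)_{n\in\mathbb N})$ is an equivalence relation if and only if it is an $\ell_p$-like equivalence relation, i.e. if and only if there exist $p\ge 1$ and pseudo-metrics $d_n$ on $X_n$ ($n\in\mathbb N$) such that $E((X_n,\psi_n)_{n\in\mathbb N})=E((X_n,d_n)_{n\in\mathbb N};p)$.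
   Context: $\mathbb R^+$ denotes the set of non-negative real numbers. For non-empty sets $X_n$ and functions $\psi_n:X_n^2\to\mathbb R^+$, the relation $E((X_n,\psi_n)_{n\in\mathbb N})$ on $\prod_{n\in\mathbb N}X_n$ is defined by $(x,y)\in E((X_n,\psi_n)_{n\in\mathbb N})\iff\sum_{n\in\mathbb N}\psi_n(x(n),y(n))<+\infty$. For pseudo-metric spaces $(X_n,d_n)$, $n\in\mathbb N$, and $p\ge 1$, the $\ell_p$-like equivalence relation $E((X_n,d_n)_{n\in\mathbb N};p)$ on $\prod_{n\in\mathbb N}X_n$ is defined by $(x,y)\in E((X_n,d_n)_{n\in\mathbb N};p)\iff\sum_{n\in\mathbb N}d_n(x(n),y(n))^p<+\infty$. *)

theory Defs
  imports Complex_Main "HOL-Library.FuncSet"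
begin

text \<open>The factors are subsets \<open>X n\<close> of one type \<open>'a\<close>, so that their union makes sense.
  The functions involved are non-negative on the factors, hence finiteness of
  the series is the same as its summability.\<close>

definition sum_rel :: "(nat \<Rightarrow> 'a set) \<Rightarrow> (nat \<Rightarrow> 'a \<times> 'a \<Rightarrow> real) \<Rightarrow> ((nat \<Rightarrow> 'a) \<times> (nat \<Rightarrow> 'a)) set"
  where "sum_rel X \<psi> =
    {(x, y). x \<in> (\<Pi> n\<in>UNIV. X n) \<and> y \<in> (\<Pi> n\<in>UNIV. X n) \<and> summable (\<lambda>n. \<psi> n (x n, y n))}"

text \<open>Unlike in the library locale for metric spaces, distinct points may have distance zero, and
  all conditions are relative to the carrier.\<close>

definition pseudo_metric_on :: "'a set \<Rightarrow> ('a \<times> 'a \<Rightarrow> real) \<Rightarrow> bool"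
  where "pseudo_metric_on M d \<longleftrightarrow>
    (\<forall>u\<in>M. \<forall>v\<in>M. 0 \<le> d (u, v)) \<and>
    (\<forall>u\<in>M. d (u, u) = 0) \<and>
    (\<forall>u\<in>M. \<forall>v\<in>M. d (u, v) = d (v, u)) \<and>
    (\<forall>u\<in>M. \<forall>v\<in>M. \<forall>w\<in>M. d (u, w) \<le> d (u, v) + d (v, w))"

definition lp_rel :: "(nat \<Rightarrow> 'a set) \<Rightarrow> (nat \<Rightarrow> 'a \<times> 'a \<Rightarrow> real) \<Rightarrow> real \<Rightarrow> ((nat \<Rightarrow> 'a) \<times> (nat \<Rightarrow> 'a)) set"
  where "lp_rel X d p =
    {(x, y). x \<in> (\<Pi> n\<in>UNIV. X n) \<and> y \<in> (\<Pi> n\<in>UNIV. X n) \<and> summable (\<lambda>n. d n (x n, y n) powr p)}"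

end

(* If E is an equivalence relation, then on triples from a common factor the symmetrised function
   sigma(u, w) = min 1 (Psi(u, w) + Psi(w, u)) is bounded by C * (Psi(u, v) + Psi(v, w)) for a single
   constant C. Otherwise pick triples violating the bound with constants 2^(k+1); each lives in
   infinitely many factors, so it can be repeated until the left-hand sides add up to at least 1
   while the right-hand sides add up to at most 2^-k. Concatenating these finite blocks gives
   sequences x E y E z with x, z not related in both directions.

   Hence sigma is a symmetric quasi-metric with uniform constant. For large p the power
   rho = sigma^(1/p) satisfies rho(u, z) <= 2 max(rho(u, v), rho(v, w), rho(w, z)), and the infimum d
   of the rho-lengths of chains is a pseudo-metric with d <= rho <= 2d, so d^p, sigma and min 1 Psi
   are comparable up to constants. *)
theory Submission
  imports Defs "HOL-Library.Infinite_Set"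
begin

section \<open>Repetition and gluing of finite blocks: a constant uniform over all factors\<close>

lemma infinite_if_recurrent:
  fixes P :: "nat \<Rightarrow> bool"
  assumes recurrent: "\<And>n. P n \<Longrightarrow> \<exists>m>n. P m" and "P n"
  shows "infinite {m. P m}"
proof
  assume fin: "finite {m. P m}"
  moreover from this have "P (Max {m. P m})"
    using Max_in[OF fin] \<open>P n\<close> by blast
  ultimately show False
    using recurrent Max_ge[OF fin] by (meson mem_Collect_eq not_less)
qed

text \<open>A gliding hump: block number \<open>k\<close> starts where block \<open>k - 1\<close>
  ended. The a-sums of the blocks are dominated by a geometric series, while every block contributes
  at least 1 to the b-sum.\<close>

lemma block_sequence:
  fixes T :: "nat \<Rightarrow> 'b set" and a b :: "'b \<Rightarrow> real"
  assumes a_nonneg: "\<And>n t. t \<in> T n \<Longrightarrow> 0 \<le> a t"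
    and b_nonneg: "\<And>n t. t \<in> T n \<Longrightarrow> 0 \<le> b t"
    and blocks: "\<And>k N. \<exists>M>N. \<exists>t. (\<forall>n. t n \<in> T n) \<and>
        (\<Sum>n=N..<M. a (t n)) \<le> (1/2)^k \<and> 1 \<le> (\<Sum>n=N..<M. b (t n))"
  obtains t where "\<And>n. t n \<in> T n" "summable (\<lambda>n. a (t n))" "\<not> summable (\<lambda>n. b (t n))"
proof -
  define Q where "Q k N M t \<longleftrightarrow> N < M \<and> (\<forall>n. t n \<in> T n) \<and>
      (\<Sum>n=N..<M. a (t n)) \<le> (1/2)^k \<and> 1 \<le> (\<Sum>n=N..<M. b (t n))" for k N M t
  have "\<exists>M t. Q k N M t" for k N
    using blocks[of N k] unfolding Q_def by blast
  then obtain M s where "\<And>k N. Q k N (M k N) (s k N)"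
    by metis
  then have M: "\<And>k N. N < M k N" and s: "\<And>k N n. s k N n \<in> T n"
    and sa: "\<And>k N. (\<Sum>n=N..<M k N. a (s k N n)) \<le> (1/2)^k"
    and sb: "\<And>k N. 1 \<le> (\<Sum>n=N..<M k N. b (s k N n))"
    unfolding Q_def by blast+
  \<comment> \<open>Block \<open>k\<close> occupies the indices from \<open>e k\<close> up to, but
    excluding, \<open>e (Suc k)\<close>.\<close>
  define e where "e = rec_nat 0 (\<lambda>k N. M k N)"
  have e: "e 0 = 0" "\<And>k. e (Suc k) = M k (e k)"
    by (simp_all add: e_def)
  have "strict_mono e"
    by (simp add: strict_mono_Suc_iff e M)
  \<comment> \<open>The least such \<open>k\<close> is the number of the block containing
    \<open>n\<close>, as \<open>e\<close> starts at 0 and increases strictly.\<close>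
  define t where "t n = (let k = LEAST k. n < e (Suc k) in s k (e k) n)" for n
  have t_eq: "t n = s k (e k) n" if "n \<in> {e k..<e (Suc k)}" for k n
  proof -
    have "(LEAST k. n < e (Suc k)) = k"
    proof (rule Least_equality)
      fix j assume "n < e (Suc j)"
      then have "e k < e (Suc j)" using that by simp
      then show "k \<le> j"
        using \<open>strict_mono e\<close> by (simp add: strict_mono_less)
    qed (use that in simp)
    then show ?thesis by (simp add: t_def Let_def)
  qed
  have tT: "t n \<in> T n" for n
    by (simp add: t_def Let_def s)
  have split: "(\<Sum>n<e K. f (t n)) = (\<Sum>k<K. \<Sum>n=e k..<e (Suc k). f (s k (e k) n))"
    for f :: "'b \<Rightarrow> real" and K
  proof (induction K)
    case (Suc K)
    have "{..<e (Suc K)} = {..<e K} \<union> {e K..<e (Suc K)}"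
      using strict_mono_less[OF \<open>strict_mono e\<close>, of K "Suc K"] by auto
    then have "(\<Sum>n<e (Suc K). f (t n)) = (\<Sum>n<e K. f (t n)) + (\<Sum>n=e K..<e (Suc K). f (t n))"
      by (simp add: sum.union_disjoint ivl_disj_int)
    also have "(\<Sum>n=e K..<e (Suc K). f (t n)) = (\<Sum>n=e K..<e (Suc K). f (s K (e K) n))"
      by (rule sum.cong) (simp_all add: t_eq)
    finally show ?case using Suc by simp
  qed (simp add: e)
  have "summable (\<lambda>n. a (t n))"
  proof (rule summableI_nonneg_bounded)
    show "0 \<le> a (t n)" for n
      using a_nonneg tT by blast
    fix n
    \<comment> \<open>Since \<open>n \<le> e n\<close>, extending the range to full blocks only adds
      non-negative terms.\<close>
    have "(\<Sum>i<n. a (t i)) \<le> (\<Sum>i<e n. a (t i))"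
      using a_nonneg tT strict_mono_imp_increasing[OF \<open>strict_mono e\<close>, of n]
      by (intro sum_mono2) auto
    also have "\<dots> \<le> (\<Sum>k<n. (1/2)^k)"
      unfolding split e(2) by (intro sum_mono sa)
    also have "\<dots> \<le> (\<Sum>k. (1/2)^k)"
      by (intro sum_le_suminf) simp_all
    finally show "(\<Sum>i<n. a (t i)) \<le> (\<Sum>k. (1/2)^k)" .
  qed
  moreover have "\<not> summable (\<lambda>n. b (t n))"
  proof
    assume sum: "summable (\<lambda>n. b (t n))"
    have "real K \<le> (\<Sum>n. b (t n))" for K
    proof -
      have "real K = (\<Sum>k<K. 1)" by simp
      also have "\<dots> \<le> (\<Sum>n<e K. b (t n))"
        unfolding split e(2) by (intro sum_mono sb)
      also have "\<dots> \<le> (\<Sum>n. b (t n))"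
        using b_nonneg tT by (intro sum_le_suminf sum) blast+
      finally show ?thesis .
    qed
    then show False
      using reals_Archimedean2 not_less by metis
  qed
  ultimately show thesis using that tT by blast
qed

text \<open>If every constant \<open>2 * 2^k\<close> fails, each \<open>k\<close> has a bad point.
  Recurrence allows it to be repeated in later factors, points with \<open>a t = 0\<close> fill the
  places in between, and the blocks required by \<open>block_sequence\<close> arise.\<close>

lemma uniform_domination:
  fixes T :: "nat \<Rightarrow> 'b set" and a b :: "'b \<Rightarrow> real"
  assumes recurrent: "\<And>n t. t \<in> T n \<Longrightarrow> \<exists>m>n. t \<in> T m"
    and zero: "\<And>n. \<exists>t\<in>T n. a t = 0"
    and a_nonneg: "\<And>n t. t \<in> T n \<Longrightarrow> 0 \<le> a t"
    and b_nonneg: "\<And>n t. t \<in> T n \<Longrightarrow> 0 \<le> b t"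
    and b_le: "\<And>n t. t \<in> T n \<Longrightarrow> b t \<le> 1"
    and summable: "\<And>t. (\<And>n. t n \<in> T n) \<Longrightarrow> summable (\<lambda>n. a (t n)) \<Longrightarrow> summable (\<lambda>n. b (t n))"
  shows "\<exists>C\<ge>1. \<forall>n. \<forall>t\<in>T n. b t \<le> C * a t"
proof (rule ccontr)
  assume unbounded: "\<not> ?thesis"
  have "\<exists>M>N. \<exists>t. (\<forall>n. t n \<in> T n) \<and>
      (\<Sum>n=N..<M. a (t n)) \<le> (1/2)^k \<and> 1 \<le> (\<Sum>n=N..<M. b (t n))" for k N
  proof -
    \<comment> \<open>The leading 2 absorbs the rounding in \<open>R\<close>: the copies of
      \<open>t0\<close> may contribute up to 2 to the b-sum, and still their a-sum is at most
      \<open>(1/2)^k\<close>.\<close>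
    have "(1::real) \<le> 2 * 2^k"
      using one_le_power[of "2::real" k] by linarith
    with unbounded have "\<not> (\<forall>n. \<forall>t\<in>T n. b t \<le> 2 * 2^k * a t)" by blast
    then obtain n0 t0 where t0: "t0 \<in> T n0" "2 * 2^k * a t0 < b t0"
      by (auto simp: not_le)
    have "0 \<le> 2 * 2^k * a t0" using a_nonneg t0 by simp
    then have pos: "0 < b t0" using t0 by linarith
    \<comment> \<open>The fewest copies of \<open>t0\<close> whose b-values add up to 1; the
      overshoot is at most \<open>b t0\<close>, hence at most 1.\<close>
    define R where "R = nat \<lceil>1 / b t0\<rceil>"
    have R_eq: "real R = of_int \<lceil>1 / b t0\<rceil>"
      using pos by (simp add: R_def)
    have "1 / b t0 \<le> R" "R \<le> 1 / b t0 + 1"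
      unfolding R_eq by linarith+
    then have Rb: "1 \<le> R * b t0" "R * b t0 \<le> 1 + b t0"
      using pos by (simp_all add: field_simps)
    have "infinite ({m. t0 \<in> T m} - {..<N})"
      using recurrent t0(1) by (intro Diff_infinite_finite infinite_if_recurrent) auto
    then obtain I where I: "finite I" "card I = R" "I \<subseteq> {m. t0 \<in> T m} - {..<N}"
      using infinite_arbitrarily_large by blast
    obtain z where z: "\<And>n. z n \<in> T n" "\<And>n. a (z n) = 0"
      using zero by metis
    define M where "M = Suc (Max (insert N I))"
    define t where "t n = (if n \<in> I then t0 else z n)" for n
    have tT: "t n \<in> T n" for n
      using I z by (auto simp: t_def)
    have "N < M" and IM: "I \<subseteq> {N..<M}"
      using I by (auto simp: M_def less_Suc_eq_le)
    have on_I: "(\<Sum>n\<in>I. f (t n)) = R * f t0" for f :: "'b \<Rightarrow> real"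
      using I by (simp add: t_def)
    have "(\<Sum>n=N..<M. a (t n)) = (\<Sum>n\<in>I. a (t n))"
      by (rule sum.mono_neutral_right) (use IM z in \<open>auto simp: t_def\<close>)
    also have "\<dots> = R * a t0" by (rule on_I)
    also have "\<dots> \<le> R * (b t0 / (2 * 2^k))"
      using t0 by (intro mult_left_mono) (simp_all add: field_simps)
    also have "\<dots> = (R * b t0) / (2 * 2^k)" by simp
    also have "\<dots> \<le> 2 / (2 * 2^k)"
      using Rb b_le[OF t0(1)] by (intro divide_right_mono) simp_all
    also have "\<dots> = (1/2)^k" by (simp add: power_one_over)
    finally have A: "(\<Sum>n=N..<M. a (t n)) \<le> (1/2)^k" .
    \<comment> \<open>The fillers vanish under \<open>a\<close> but may be positive under
      \<open>b\<close>, which only helps this lower bound.\<close>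
    have "1 \<le> (\<Sum>n\<in>I. b (t n))" using Rb on_I by simp
    also have "\<dots> \<le> (\<Sum>n=N..<M. b (t n))"
      using IM b_nonneg tT by (intro sum_mono2) auto
    finally show ?thesis using \<open>N < M\<close> tT A by blast
  qed
  then obtain t where "\<And>n. t n \<in> T n" "summable (\<lambda>n. a (t n))" "\<not> summable (\<lambda>n. b (t n))"
    using block_sequence[of T a b] a_nonneg b_nonneg by metis
  with summable show False by blast
qed

section \<open>From a four-point inequality to a pseudo-metric, by chains\<close>

lemma chain_bound:
  fixes \<rho> :: "'a \<Rightarrow> 'a \<Rightarrow> real"
  assumes nonneg: "\<And>u v. u \<in> M \<Longrightarrow> v \<in> M \<Longrightarrow> 0 \<le> \<rho> u v"
    and refl: "\<And>u. u \<in> M \<Longrightarrow> \<rho> u u = 0"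
    and four_point: "\<And>u v w z. u \<in> M \<Longrightarrow> v \<in> M \<Longrightarrow> w \<in> M \<Longrightarrow> z \<in> M \<Longrightarrow>
        \<rho> u z \<le> 2 * max (\<rho> u v) (max (\<rho> v w) (\<rho> w z))"
    and "\<And>i. x i \<in> M" "m \<le> n"
  shows "\<rho> (x m) (x n) \<le> 2 * (\<Sum>i=m..<n. \<rho> (x i) (x (Suc i)))"
  \<comment> \<open>Split the chain at the step that contains its midpoint in length: both remaining parts have at
    most half the length, and the induction hypothesis bounds \<open>\<rho>\<close> on each by the total length.\<close>
  using \<open>m \<le> n\<close>
proof (induction "n - m" arbitrary: m n rule: less_induct)
  case less
  define L where "L m n = (\<Sum>i=m..<n. \<rho> (x i) (x (Suc i)))" for m n
  have L_nonneg: "0 \<le> L m n" for m n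
    using assms by (auto simp: L_def intro: sum_nonneg)
  have L_add: "L m k + L k n = L m n" if "m \<le> k" "k \<le> n" for m k n
    using that by (simp add: L_def sum.atLeastLessThan_concat)
  have L_Suc: "L k (Suc k) = \<rho> (x k) (x (Suc k))" for k
    by (simp add: L_def)
  show ?case
  proof (cases "m = n")
    case True
    then show ?thesis using assms by simp
  next
    case False
    define K where "K = {k. m \<le> k \<and> k < n \<and> 2 * L m k \<le> L m n}"
    have "finite K" by (auto simp: K_def)
    have "m \<in> K" using False less.prems L_nonneg by (simp add: K_def L_def)
    define k where "k = Max K"
    have "k \<in> K" using \<open>finite K\<close> \<open>m \<in> K\<close> Max_in k_def by blast
    then have k: "m \<le> k" "k < n" "2 * L m k \<le> L m n" by (auto simp: K_def)
    \<comment> \<open>If \<open>Suc k = n\<close>, nothing remains after the middle step;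
      \<open>K\<close> contains only indices below \<open>n\<close>, so maximality of
      \<open>k\<close> says nothing there.\<close>
    have "L (Suc k) n \<le> L m n / 2"
    proof (cases "Suc k = n")
      case True
      then show ?thesis using L_nonneg[of m n] by (simp add: L_def)
    next
      case False
      have "Suc k \<notin> K"
        using Max_ge[OF \<open>finite K\<close>, of "Suc k"] by (auto simp: k_def)
      then have "L m n < 2 * L m (Suc k)" using k False by (auto simp: K_def)
      then show ?thesis using L_add[of m "Suc k" n] k by simp
    qed
    moreover have "\<rho> (x (Suc k)) (x n) \<le> 2 * L (Suc k) n"
      unfolding L_def by (rule less.hyps) (use k in auto)
    ultimately have "\<rho> (x (Suc k)) (x n) \<le> L m n" by simp
    moreover have "\<rho> (x m) (x k) \<le> 2 * L m k"
      unfolding L_def by (rule less.hyps) (use k in auto)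
    then have "\<rho> (x m) (x k) \<le> L m n" using k by simp
    moreover have "\<rho> (x k) (x (Suc k)) \<le> L m n"
      using L_add[of m k n] L_add[of k "Suc k" n] k L_nonneg[of m k] L_nonneg[of "Suc k" n]
      by (simp add: L_Suc)
    ultimately show ?thesis
      using four_point[of "x m" "x k" "x (Suc k)" "x n"] assms(4) by (fastforce simp: L_def)
  qed
qed

text \<open>The chain construction of Frink's metrization lemma. Concatenating chains gives the
  triangle inequality, the one-step chain gives the upper bound \<open>\<rho>\<close>, and
  \<open>chain_bound\<close> keeps the infimum from dropping below half of
  \<open>\<rho>\<close>.\<close>

lemma chain_pseudo_metric:
  fixes \<rho> :: "'a \<Rightarrow> 'a \<Rightarrow> real"
  assumes nonneg: "\<And>u v. u \<in> M \<Longrightarrow> v \<in> M \<Longrightarrow> 0 \<le> \<rho> u v"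
    and refl: "\<And>u. u \<in> M \<Longrightarrow> \<rho> u u = 0"
    and sym: "\<And>u v. u \<in> M \<Longrightarrow> v \<in> M \<Longrightarrow> \<rho> u v = \<rho> v u"
    and four_point: "\<And>u v w z. u \<in> M \<Longrightarrow> v \<in> M \<Longrightarrow> w \<in> M \<Longrightarrow> z \<in> M \<Longrightarrow>
        \<rho> u z \<le> 2 * max (\<rho> u v) (max (\<rho> v w) (\<rho> w z))"
  obtains d where "pseudo_metric_on M d"
    "\<And>u v. u \<in> M \<Longrightarrow> v \<in> M \<Longrightarrow> d (u, v) \<le> \<rho> u v"
    "\<And>u v. u \<in> M \<Longrightarrow> v \<in> M \<Longrightarrow> \<rho> u v \<le> 2 * d (u, v)"
proof -
  \<comment> \<open>A chain is an infinite sequence in \<open>M\<close> of which only the first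
    \<open>n\<close> steps count. For \<open>n = 0\<close> this includes the empty chain from
    \<open>u\<close> to itself.\<close>
  define S where "S u v = {\<Sum>i<n. \<rho> (x i) (x (Suc i)) | x n. (\<forall>i. x i \<in> M) \<and> x 0 = u \<and> x n = v}"
    for u v
  define d where "d = (\<lambda>(u, v). Inf (S u v))"
  have step: "\<rho> u v \<in> S u v" if "u \<in> M" "v \<in> M" for u v
    unfolding S_def
    by (rule CollectI, rule exI[of _ "\<lambda>i. if i = 0 then u else v"], rule exI[of _ 1])
      (use that in simp)
  have empty: "0 \<in> S u u" if "u \<in> M" for u
    unfolding S_def
    by (rule CollectI, rule exI[of _ "\<lambda>i. u"], rule exI[of _ 0]) (use that in simp)
  have nonneg_S: "0 \<le> s" if "s \<in> S u v" for s u v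
    using that nonneg by (auto simp: S_def intro!: sum_nonneg)
  have bdd: "bdd_below (S u v)" for u v
    by (rule bdd_belowI[of _ 0]) (rule nonneg_S)
  have S_sym: "S u v \<subseteq> S v u" for u v
  proof
    fix s assume "s \<in> S u v"
    then obtain x n where s: "s = (\<Sum>i<n. \<rho> (x i) (x (Suc i)))" and x: "\<And>i. x i \<in> M" "x 0 = u" "x n = v"
      by (auto simp: S_def)
    \<comment> \<open>The reversed chain is \<open>\<lambda>i. x (n - i)\<close>; truncated
      subtraction keeps it at \<open>u\<close> beyond \<open>n\<close>, hence inside
      \<open>M\<close>.\<close>
    have "s = (\<Sum>i<n. \<rho> (x (n - Suc i)) (x (Suc (n - Suc i))))"
      unfolding s by (rule sum.nat_diff_reindex[symmetric])
    also have "\<dots> = (\<Sum>i<n. \<rho> (x (n - i)) (x (n - Suc i)))"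
      using x sym by (intro sum.cong) (simp_all add: Suc_diff_Suc)
    finally show "s \<in> S v u"
      using x unfolding S_def
      by (intro CollectI exI[of _ "\<lambda>i. x (n - i)"] exI[of _ n]) simp
  qed
  have S_trans: "s + s' \<in> S u w" if "s \<in> S u v" "s' \<in> S v w" for s s' u v w
  proof -
    obtain x n where s: "s = (\<Sum>i<n. \<rho> (x i) (x (Suc i)))" and x: "\<And>i. x i \<in> M" "x 0 = u" "x n = v"
      using \<open>s \<in> S u v\<close> by (auto simp: S_def)
    obtain y m where s': "s' = (\<Sum>i<m. \<rho> (y i) (y (Suc i)))" and y: "\<And>i. y i \<in> M" "y 0 = v" "y m = w"
      using \<open>s' \<in> S v w\<close> by (auto simp: S_def)
    \<comment> \<open>Both pieces take the value \<open>v\<close> at index \<open>n\<close>, so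
      \<open>z (n + i) = y i\<close> holds for \<open>i = 0\<close> as well.\<close>
    define z where "z i = (if i \<le> n then x i else y (i - n))" for i
    have z_add: "z (n + i) = y i" for i
      using x y by (simp add: z_def)
    have "(\<Sum>i<n + m. \<rho> (z i) (z (Suc i))) =
        (\<Sum>i<n. \<rho> (z i) (z (Suc i))) + (\<Sum>i<m. \<rho> (z (n + i)) (z (n + Suc i)))"
      by (induction m) simp_all
    also have "\<dots> = s + s'"
      unfolding z_add s s' by (simp add: z_def)
    finally show ?thesis
      using x y z_add[of m] unfolding S_def
      by (intro CollectI exI[of _ z] exI[of _ "n + m"]) (auto simp: z_def)
  qed
  have lower: "\<rho> u v \<le> 2 * s" if "s \<in> S u v" for s u v
    using that chain_bound[of M \<rho> _ 0] assms(1,2,4) by (auto simp: S_def atLeast0LessThan)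
  have triangle: "d (u, w) \<le> d (u, v) + d (v, w)" if "u \<in> M" "v \<in> M" "w \<in> M" for u v w
  proof -
    \<comment> \<open>The infima are taken one after the other: first over chains from
      \<open>u\<close> to \<open>v\<close> with \<open>s'\<close> fixed, then over
      \<open>s'\<close>.\<close>
    have "d (u, w) - s' \<le> d (u, v)" if "s' \<in> S v w" for s'
      unfolding d_def prod.case
    proof (rule cInf_greatest)
      show "S u v \<noteq> {}" using step \<open>u \<in> M\<close> \<open>v \<in> M\<close> by blast
      fix s assume "s \<in> S u v"
      then show "Inf (S u w) - s' \<le> s"
        using cInf_lower[OF S_trans bdd] that by (simp add: diff_le_eq)
    qed
    then have "d (u, w) - d (u, v) \<le> s'" if "s' \<in> S v w" for s'
      using that by (simp add: algebra_simps)
    then have "d (u, w) - d (u, v) \<le> d (v, w)"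
      unfolding d_def prod.case
      using step \<open>v \<in> M\<close> \<open>w \<in> M\<close> by (intro cInf_greatest) blast+
    then show ?thesis by simp
  qed
  show thesis
  proof
    show "pseudo_metric_on M d"
      unfolding pseudo_metric_on_def
    proof (intro conjI ballI)
      fix u v assume "u \<in> M" "v \<in> M"
      then have "S u v \<noteq> {}" using step by blast
      then show "0 \<le> d (u, v)"
        using nonneg_S by (auto simp: d_def intro!: cInf_greatest)
    next
      fix u assume "u \<in> M"
      then show "d (u, u) = 0"
        using empty nonneg_S by (auto simp: d_def intro!: cInf_eq_minimum)
    next
      fix u v show "d (u, v) = d (v, u)"
        using S_sym[of u v] S_sym[of v u] by (simp add: d_def subset_antisym)
    qed (rule triangle)
    fix u v assume "u \<in> M" "v \<in> M"
    then show "d (u, v) \<le> \<rho> u v"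
      using cInf_lower[OF step bdd] by (simp add: d_def)
    have "\<rho> u v / 2 \<le> d (u, v)"
      unfolding d_def prod.case
      using step[OF \<open>u \<in> M\<close> \<open>v \<in> M\<close>] lower by (intro cInf_greatest) fastforce+
    then show "\<rho> u v \<le> 2 * d (u, v)" by simp
  qed
qed

section \<open>The l_p-like relations, and truncation of series at 1\<close>

lemma powr_add_le:
  fixes a b p :: real
  assumes "0 \<le> a" "0 \<le> b" "0 \<le> p"
  shows "(a + b) powr p \<le> 2 powr p * (a powr p + b powr p)"
proof -
  have "(a + b) powr p \<le> (2 * max a b) powr p"
    using assms by (intro powr_mono2) auto
  also have "\<dots> = 2 powr p * max a b powr p"
    using assms by (simp add: powr_mult)
  also have "\<dots> \<le> 2 powr p * (a powr p + b powr p)"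
    by (intro mult_left_mono) (simp_all add: max_def)
  finally show ?thesis .
qed

lemma equiv_lp_rel:
  assumes "0 \<le> p" and d: "\<And>n. pseudo_metric_on (X n) (d n)"
  shows "equiv (\<Pi> n\<in>UNIV. X n) (lp_rel X d p)"
proof (rule equivI)
  show "lp_rel X d p \<subseteq> (\<Pi> n\<in>UNIV. X n) \<times> (\<Pi> n\<in>UNIV. X n)"
    by (auto simp: lp_rel_def)
  show "refl_on (\<Pi> n\<in>UNIV. X n) (lp_rel X d p)"
    using d by (auto simp: refl_on_def lp_rel_def pseudo_metric_on_def Pi_iff)
  show "sym (lp_rel X d p)"
  proof (rule symI)
    fix x y assume xy: "(x, y) \<in> lp_rel X d p"
    then have "d n (x n, y n) = d n (y n, x n)" for n
      using d by (auto simp: lp_rel_def pseudo_metric_on_def Pi_iff)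
    with xy show "(y, x) \<in> lp_rel X d p" by (simp add: lp_rel_def)
  qed
  show "trans (lp_rel X d p)"
  proof (rule transI)
    fix x y z assume xy: "(x, y) \<in> lp_rel X d p" and yz: "(y, z) \<in> lp_rel X d p"
    have mem: "x n \<in> X n" "y n \<in> X n" "z n \<in> X n" for n
      using xy yz by (auto simp: lp_rel_def)
    \<comment> \<open>A termwise comparison with the constant \<open>2 powr p\<close> takes the
      place of Minkowski's inequality.\<close>
    have "summable (\<lambda>n. d n (x n, z n) powr p)"
    proof (rule summable_comparison_test_ev)
      show "summable (\<lambda>n. 2 powr p * (d n (x n, y n) powr p + d n (y n, z n) powr p))"
        using xy yz by (intro summable_mult summable_add) (simp_all add: lp_rel_def)
      have "d n (x n, z n) powr p \<le> 2 powr p * (d n (x n, y n) powr p + d n (y n, z n) powr p)" for n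
      proof -
        have "d n (x n, z n) powr p \<le> (d n (x n, y n) + d n (y n, z n)) powr p"
          using d[of n] mem[of n] \<open>0 \<le> p\<close> unfolding pseudo_metric_on_def
          by (intro powr_mono2) blast+
        also have "\<dots> \<le> 2 powr p * (d n (x n, y n) powr p + d n (y n, z n) powr p)"
          using d[of n] mem[of n] \<open>0 \<le> p\<close> unfolding pseudo_metric_on_def
          by (intro powr_add_le) blast+
        finally show ?thesis .
      qed
      then show "\<forall>\<^sub>F n in sequentially. norm (d n (x n, z n) powr p) \<le>
          2 powr p * (d n (x n, y n) powr p + d n (y n, z n) powr p)"
        by simp
    qed
    with xy yz show "(x, z) \<in> lp_rel X d p" by (simp add: lp_rel_def)
  qed
qed

text \<open>The terms of a convergent series tend to 0, so the truncation is eventually inactive.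
  This permits passing to functions bounded by 1.\<close>

lemma summable_min_one_iff:
  fixes f :: "nat \<Rightarrow> real"
  assumes "\<And>n. 0 \<le> f n"
  shows "summable (\<lambda>n. min 1 (f n)) \<longleftrightarrow> summable f"
proof
  assume sum: "summable (\<lambda>n. min 1 (f n))"
  then have "(\<lambda>n. min 1 (f n)) \<longlonglongrightarrow> 0" by (rule summable_LIMSEQ_zero)
  then have "\<forall>\<^sub>F n in sequentially. min 1 (f n) < 1"
    by (rule order_tendstoD) simp
  then have "\<forall>\<^sub>F n in sequentially. norm (f n) \<le> min 1 (f n)"
    by eventually_elim (use assms in auto)
  then show "summable f" using sum by (rule summable_comparison_test_ev)
next
  assume "summable f"
  then show "summable (\<lambda>n. min 1 (f n))"
    by (rule summable_comparison_test_ev[rotated]) (use assms in auto)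
qed

section \<open>The two directions of the characterization\<close>

theorem theorem3p5:
  fixes X :: "nat \<Rightarrow> 'a set" and \<psi> :: "nat \<Rightarrow> 'a \<times> 'a \<Rightarrow> real"
  assumes nonempty: "\<And>n. X n \<noteq> {}"
    and nonneg: "\<And>n. \<psi> n \<in> X n \<times> X n \<rightarrow> {0..}"
    and m1: "\<exists>!\<Psi>. \<Psi> \<in> (\<Union>n. X n) \<times> (\<Union>n. X n) \<rightarrow>\<^sub>E {0::real..} \<and>
        (\<forall>n. \<forall>u\<in>X n. \<forall>v\<in>X n. \<psi> n (u, v) = \<Psi> (u, v)) \<and>
        (\<forall>u\<in>(\<Union>n. X n). \<forall>v\<in>(\<Union>n. X n). (\<nexists>n. u \<in> X n \<and> v \<in> X n) \<longrightarrow> \<Psi> (u, v) = 1)"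
    and m2: "\<And>n u v r. u \<in> X n \<Longrightarrow> v \<in> X n \<Longrightarrow> r \<in> X n \<Longrightarrow>
        \<exists>m>n. u \<in> X m \<and> v \<in> X m \<and> r \<in> X m"
  shows "equiv (\<Pi> n\<in>UNIV. X n) (sum_rel X \<psi>) \<longleftrightarrow>
    (\<exists>p\<ge>1. \<exists>d. (\<forall>n. pseudo_metric_on (X n) (d n)) \<and> sum_rel X \<psi> = lp_rel X d p)"
proof
  assume "\<exists>p\<ge>1. \<exists>d. (\<forall>n. pseudo_metric_on (X n) (d n)) \<and> sum_rel X \<psi> = lp_rel X d p"
  then obtain p d where "1 \<le> p" "\<And>n. pseudo_metric_on (X n) (d n)" "sum_rel X \<psi> = lp_rel X d p"
    by blast
  then show "equiv (\<Pi> n\<in>UNIV. X n) (sum_rel X \<psi>)"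
    using equiv_lp_rel[of p X d] by simp
next
  assume equiv: "equiv (\<Pi> n\<in>UNIV. X n) (sum_rel X \<psi>)"
  \<comment> \<open>With a common \<open>\<Psi>\<close> the value at a pair is the same in every
    factor containing it, so repeating a tuple in several factors repeats its values.\<close>
  obtain \<Psi> where \<Psi>: "\<And>n u v. u \<in> X n \<Longrightarrow> v \<in> X n \<Longrightarrow> \<psi> n (u, v) = \<Psi> (u, v)"
    using ex1_implies_ex[OF m1] by (elim exE conjE) simp
  have \<Psi>_nonneg: "0 \<le> \<Psi> (u, v)" if "u \<in> X n" "v \<in> X n" for u v n
    using funcset_mem[OF nonneg[of n], of "(u, v)"] that \<Psi> by simp
  have rel_iff: "(x, y) \<in> sum_rel X \<psi> \<longleftrightarrow> summable (\<lambda>n. \<Psi> (x n, y n))"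
    if "\<And>n. x n \<in> X n" "\<And>n. y n \<in> X n" for x y
    using that \<Psi> by (auto simp: sum_rel_def)
  \<comment> \<open>Reflexivity is applied to a sequence equal to \<open>u\<close> in each of the
    infinitely many factors containing \<open>u\<close>: its terms tend to 0, yet
    \<open>\<Psi> (u, u)\<close> recurs among them.\<close>
  have \<Psi>_refl: "\<Psi> (u, u) = 0" if u: "u \<in> X n" for u n
  proof -
    have "infinite {m. u \<in> X m}"
      using m2 u by (intro infinite_if_recurrent) blast+
    then have frequent: "\<exists>m>k. u \<in> X m" for k
      by (simp add: infinite_nat_iff_unbounded)
    define x where "x n = (if u \<in> X n then u else (SOME v. v \<in> X n))" for n
    have "x n \<in> X n" for n using nonempty by (simp add: x_def some_in_eq)
    moreover from this have "(x, x) \<in> sum_rel X \<psi>"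
      using equiv by (auto simp: equiv_def refl_on_def)
    ultimately have "(\<lambda>n. \<Psi> (x n, x n)) \<longlonglongrightarrow> 0"
      using rel_iff summable_LIMSEQ_zero by blast
    then have "\<bar>\<Psi> (u, u)\<bar> < e" if "e > 0" for e
    proof -
      obtain k where "\<And>n. n \<ge> k \<Longrightarrow> \<bar>\<Psi> (x n, x n)\<bar> < e"
        using LIMSEQ_D[OF \<open>(\<lambda>n. \<Psi> (x n, x n)) \<longlonglongrightarrow> 0\<close> \<open>e > 0\<close>] by auto
      then show ?thesis using frequent[of k] by (metis x_def less_imp_le)
    qed
    then show ?thesis by (metis less_irrefl zero_less_abs_iff)
  qed
  define \<sigma> where "\<sigma> u v = min 1 (\<Psi> (u, v) + \<Psi> (v, u))" for u v
  have \<sigma>_sym: "\<sigma> u v = \<sigma> v u" for u v by (simp add: \<sigma>_def add.commute)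
  have \<sigma>_nonneg: "0 \<le> \<sigma> u v" if "u \<in> X n" "v \<in> X n" for u v n
    using \<Psi>_nonneg that by (simp add: \<sigma>_def)
  define T where "T n = X n \<times> X n \<times> X n" for n
  define a where "a = (\<lambda>(u, v, w). \<Psi> (u, v) + \<Psi> (v, w))"
  define b where "b = (\<lambda>(u, v::'a, w). \<sigma> u w)"
  have "\<exists>C\<ge>1. \<forall>n. \<forall>t\<in>T n. b t \<le> C * a t"
  proof (rule uniform_domination)
    fix n t assume "t \<in> T n"
    then show "\<exists>m>n. t \<in> T m" "0 \<le> a t" "0 \<le> b t" "b t \<le> 1"
      using m2 \<Psi>_nonneg \<sigma>_nonneg by (auto simp: T_def a_def b_def \<sigma>_def)
  next
    fix n
    obtain u where "u \<in> X n" using nonempty by blast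
    then show "\<exists>t\<in>T n. a t = 0"
      by (intro bexI[of _ "(u, u, u)"]) (auto simp: T_def a_def \<Psi>_refl)
  next
    fix t assume t: "\<And>n. t n \<in> T n" and sum: "summable (\<lambda>n. a (t n))"
    define x y z where "x n = fst (t n)" and "y n = fst (snd (t n))" and "z n = snd (snd (t n))" for n
    have t_eq: "t n = (x n, y n, z n)" for n by (simp add: x_def y_def z_def)
    have mem: "x n \<in> X n" "y n \<in> X n" "z n \<in> X n" for n
      using t[of n] by (auto simp: T_def t_eq)
    have "norm (\<Psi> (x n, y n)) \<le> a (t n)" "norm (\<Psi> (y n, z n)) \<le> a (t n)" for n
      using \<Psi>_nonneg[OF mem(1,2)[of n]] \<Psi>_nonneg[OF mem(2,3)[of n]] by (simp_all add: a_def t_eq)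
    then have "summable (\<lambda>n. \<Psi> (x n, y n))" "summable (\<lambda>n. \<Psi> (y n, z n))"
      using sum by (auto intro: summable_comparison_test')
    then have "(x, y) \<in> sum_rel X \<psi>" "(y, z) \<in> sum_rel X \<psi>"
      using rel_iff mem by blast+
    \<comment> \<open>Both orders are wanted because \<open>\<sigma>\<close> adds the two values of
      \<open>\<Psi>\<close>.\<close>
    then have "(x, z) \<in> sum_rel X \<psi>" "(z, x) \<in> sum_rel X \<psi>"
      using equiv by (meson equivE symE transE)+
    then have "summable (\<lambda>n. \<Psi> (x n, z n) + \<Psi> (z n, x n))"
      using rel_iff mem by (intro summable_add) blast+
    moreover have "0 \<le> \<Psi> (x n, z n) + \<Psi> (z n, x n)" for n
      using \<Psi>_nonneg mem by (meson add_nonneg_nonneg)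
    ultimately show "summable (\<lambda>n. b (t n))"
      by (simp add: b_def t_eq \<sigma>_def summable_min_one_iff)
  qed
  then obtain C where C: "C \<ge> 1" and "\<And>n t. t \<in> T n \<Longrightarrow> b t \<le> C * a t"
    by blast
  then have C_le: "\<sigma> u w \<le> C * (\<Psi> (u, v) + \<Psi> (v, w))"
    if "u \<in> X n" "v \<in> X n" "w \<in> X n" for n u v w
    using that by (fastforce simp: T_def a_def b_def)
  \<comment> \<open>If both truncations on the right are inactive, \<open>\<sigma>\<close> dominates
    \<open>\<Psi>\<close> there. Otherwise the right-hand side is at least 1, an upper bound of
    \<open>\<sigma>\<close>.\<close>
  have quasi: "\<sigma> u w \<le> C * (\<sigma> u v + \<sigma> v w)" if "u \<in> X n" "v \<in> X n" "w \<in> X n" for u v w n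
  proof (cases "\<sigma> u v < 1 \<and> \<sigma> v w < 1")
    case True
    then have "\<Psi> (u, v) \<le> \<sigma> u v" "\<Psi> (v, w) \<le> \<sigma> v w"
      using \<Psi>_nonneg[OF that(2,1)] \<Psi>_nonneg[OF that(3,2)]
      by (auto simp: \<sigma>_def min_def split: if_splits)
    then have "C * (\<Psi> (u, v) + \<Psi> (v, w)) \<le> C * (\<sigma> u v + \<sigma> v w)"
      using C by (intro mult_left_mono) auto
    with C_le[OF that] show ?thesis by linarith
  next
    case False
    then have "1 \<le> \<sigma> u v + \<sigma> v w"
      using \<sigma>_nonneg[OF that(1,2)] \<sigma>_nonneg[OF that(2,3)] by linarith
    then have "1 * 1 \<le> C * (\<sigma> u v + \<sigma> v w)"
      using C by (intro mult_mono) auto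
    then show ?thesis by (simp add: \<sigma>_def)
  qed
  \<comment> \<open>Two uses of \<open>quasi\<close> bound \<open>\<sigma> u z\<close> by
    \<open>C * (C * m + 2 * C * m)\<close>, where \<open>m\<close> is the largest of the three
    steps. The exponent satisfies \<open>2 powr p = 2 * K\<close>, so the p-th root of
    \<open>K\<close> is at most 2.\<close>
  define K where "K = 3 * C\<^sup>2"
  define p where "p = 1 + log 2 K"
  have "1 \<le> C\<^sup>2" using C by simp
  then have K: "1 \<le> K" by (simp add: K_def)
  then have p: "1 \<le> p" by (simp add: p_def)
  have K_root: "K powr (1 / p) \<le> 2"
  proof -
    have "K powr (1 / p) \<le> (2 powr p) powr (1 / p)"
      using K p by (intro powr_mono2) (simp_all add: p_def powr_add)
    then show ?thesis using p by (simp add: powr_powr)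
  qed
  define \<rho> where "\<rho> u v = \<sigma> u v powr (1 / p)" for u v
  have four_point: "\<rho> u z \<le> 2 * max (\<rho> u v) (max (\<rho> v w) (\<rho> w z))"
    if mem: "u \<in> X n" "v \<in> X n" "w \<in> X n" "z \<in> X n" for u v w z n
  proof -
    define m where "m = max (\<sigma> u v) (max (\<sigma> v w) (\<sigma> w z))"
    have m: "0 \<le> m" "\<sigma> u v \<le> m" "\<sigma> v w \<le> m" "\<sigma> w z \<le> m"
      using \<sigma>_nonneg[OF mem(1,2)] by (auto simp: m_def)
    have "\<sigma> v z \<le> C * (\<sigma> v w + \<sigma> w z)" by (rule quasi) (use mem in auto)
    also have "\<dots> \<le> C * (m + m)" using C m by (intro mult_left_mono add_mono) auto
    finally have vz: "\<sigma> v z \<le> C * (m + m)" .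
    have "m \<le> C * m" using C m by (simp add: mult_le_cancel_right1)
    have "\<sigma> u z \<le> C * (\<sigma> u v + \<sigma> v z)" by (rule quasi) (use mem in auto)
    also have "\<dots> \<le> C * (C * m + C * (m + m))"
      using C m vz \<open>m \<le> C * m\<close> by (intro mult_left_mono add_mono) auto
    also have "\<dots> = K * m" by (simp add: K_def power2_eq_square algebra_simps)
    finally have "\<rho> u z \<le> (K * m) powr (1 / p)"
      unfolding \<rho>_def using \<sigma>_nonneg mem p by (intro powr_mono2) auto
    also have "\<dots> = K powr (1 / p) * m powr (1 / p)"
      using K m by (simp add: powr_mult)
    also have "\<dots> \<le> 2 * m powr (1 / p)"
      by (intro mult_right_mono K_root) simp
    also have "m powr (1 / p) \<le> max (\<rho> u v) (max (\<rho> v w) (\<rho> w z))"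
      unfolding m_def \<rho>_def by (auto simp: max_def)
    finally show ?thesis by simp
  qed
  \<comment> \<open>Chains stay within \<open>X n\<close>, so the metric depends on
    \<open>n\<close>; the factor 2 and the exponent \<open>p\<close> do not.\<close>
  have "\<exists>d. pseudo_metric_on (X n) d \<and>
      (\<forall>u\<in>X n. \<forall>v\<in>X n. d (u, v) \<le> \<rho> u v \<and> \<rho> u v \<le> 2 * d (u, v))" for n
  proof (rule chain_pseudo_metric[of "X n" \<rho>])
    show "\<rho> u u = 0" if "u \<in> X n" for u
      using that by (simp add: \<rho>_def \<sigma>_def \<Psi>_refl)
  qed (use four_point \<sigma>_sym in \<open>auto simp: \<rho>_def\<close>)
  then obtain d where d: "\<And>n. pseudo_metric_on (X n) (d n)"
    and d_le: "\<And>n u v. u \<in> X n \<Longrightarrow> v \<in> X n \<Longrightarrow> d n (u, v) \<le> \<rho> u v"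
    and d_ge: "\<And>n u v. u \<in> X n \<Longrightarrow> v \<in> X n \<Longrightarrow> \<rho> u v \<le> 2 * d n (u, v)"
    by metis
  have \<rho>_powr: "\<rho> u v powr p = \<sigma> u v" if "u \<in> X n" "v \<in> X n" for u v n
    using p \<sigma>_nonneg[OF that] by (simp add: \<rho>_def powr_powr)
  have iff: "summable (\<lambda>n. \<Psi> (x n, y n)) \<longleftrightarrow> summable (\<lambda>n. d n (x n, y n) powr p)"
    if mem: "\<And>n. x n \<in> X n" "\<And>n. y n \<in> X n" for x y
  proof -
    have d_nonneg: "0 \<le> d n (x n, y n)" for n
      using d mem by (auto simp: pseudo_metric_on_def)
    have \<Psi>_xy: "0 \<le> \<Psi> (x n, y n)" for n
      using \<Psi>_nonneg mem by blast
    have "d n (x n, y n) powr p \<le> C * \<Psi> (x n, y n)" for n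
    proof -
      have "d n (x n, y n) powr p \<le> \<rho> (x n) (y n) powr p"
        using d_nonneg d_le mem p by (intro powr_mono2) auto
      \<comment> \<open>\<open>C_le\<close> with second and third point both \<open>y n\<close>: as
        \<open>\<Psi>\<close> vanishes on the diagonal, this removes the reversed term
        \<open>\<Psi> (y n, x n)\<close> contained in \<open>\<sigma>\<close>.\<close>
      also have "\<dots> \<le> C * \<Psi> (x n, y n)"
        using C_le[of "x n" n "y n" "y n"] mem by (simp add: \<rho>_powr[of _ n] \<Psi>_refl[of _ n])
      finally show ?thesis .
    qed
    then have "summable (\<lambda>n. d n (x n, y n) powr p)" if "summable (\<lambda>n. \<Psi> (x n, y n))"
      by (intro summable_comparison_test_ev[OF _ summable_mult[OF that, of C]]) simp
    \<comment> \<open>Here \<open>\<Psi>\<close> must be truncated: \<open>d n\<close> is bounded by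
      \<open>\<rho>\<close>, hence by 1, whereas \<open>\<Psi>\<close> may be unbounded.\<close>
    moreover have "min 1 (\<Psi> (x n, y n)) \<le> 2 powr p * d n (x n, y n) powr p" for n
    proof -
      have "min 1 (\<Psi> (x n, y n)) \<le> \<sigma> (x n) (y n)"
        using \<Psi>_nonneg[of "y n" n "x n"] mem by (simp add: \<sigma>_def)
      also have "\<dots> = \<rho> (x n) (y n) powr p"
        using \<rho>_powr mem by metis
      also have "\<dots> \<le> (2 * d n (x n, y n)) powr p"
        using d_ge mem p by (intro powr_mono2) (auto simp: \<rho>_def)
      finally show ?thesis using d_nonneg by (simp add: powr_mult)
    qed
    then have "summable (\<lambda>n. min 1 (\<Psi> (x n, y n)))" if "summable (\<lambda>n. d n (x n, y n) powr p)"
      by (intro summable_comparison_test_ev[OF _ summable_mult[OF that, of "2 powr p"]])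
        (use \<Psi>_xy in simp)
    ultimately show ?thesis
      using summable_min_one_iff[of "\<lambda>n. \<Psi> (x n, y n)"] \<Psi>_xy by blast
  qed
  have "sum_rel X \<psi> = lp_rel X d p"
  proof (intro set_eqI, safe)
    fix x y
    show "(x, y) \<in> lp_rel X d p" if "(x, y) \<in> sum_rel X \<psi>"
      using that rel_iff[of x y] iff[of x y] by (auto simp: sum_rel_def lp_rel_def Pi_iff)
    show "(x, y) \<in> sum_rel X \<psi>" if "(x, y) \<in> lp_rel X d p"
      using that rel_iff[of x y] iff[of x y] by (auto simp: lp_rel_def Pi_iff)
  qed
  then show "\<exists>p\<ge>1. \<exists>d. (\<forall>n. pseudo_metric_on (X n) (d n)) \<and> sum_rel X \<psi> = lp_rel X d p"
    using p d by blast
qed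

end
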